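(* Proportional Approval Voting ($\mathit{PAV}$) satisfies JR: for every ballot profile $\vec{A}=(A_1,\dots,A_n)$ over a candidate set $C$ and every $k$ with $1\le k\le|C|$, every committee that can be output by $\mathit{PAV}$ on $(\vec{A},k)$ (irrespective of tie-breaking) provides justified representation for $(\vec{A},k)$.
   Context: Setting. $N=\{1,\dots,n\}$ ($n\ge 1$) is a set of voters, $C$ is a finite set of candidates. Each voter $i\in N$ submits an approval ballot $A_i\subseteq C$; the list $\vec{A}=(A_1,\dots,A_n)$ is the ballot profile. An approval-based multi-winner rule takes $(N,C,\vec{A},k)$ with $1\le k\le|C|$ and returns a committee $W\subseteq C$ with $|W|=k$. Justified representation (JR). A set $W\subseteq C$ with $|W|=k$ provides justified representation for $(\vec{A},k)$ if there is no set of voters $N^*\subseteq N$ with $|N^*|\ge \frac{n}{k}$ such that $\bigcap_{i\in N^*}A_i\neq\emptyset$ and $A_i\cap W=\emptyset$ for all $i\in N^*$. $\mathit{PAV}$: the $\mathit{PAV}$-score of $W\subseteq C$ is $\sum_{i\in N}r(|W\cap A_i|)$, where $r(p)=\sum_{j=1}^p\frac1j$; $\mathit{PAV}$ outputs a set $W\subseteq C$ of size $k$ with the highest $\mathit{PAV}$-score. *)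

theory Defs
  imports "HOL-Analysis.Harmonic_Numbers"
begin

(* The voters are the elements of {1..n}; a ballot profile is a function A of which only
   the values A 1, ..., A n are relevant. *)
definition ballot_profile :: "nat \<Rightarrow> 'c set \<Rightarrow> (nat \<Rightarrow> 'c set) \<Rightarrow> bool" where
  "ballot_profile n C A \<longleftrightarrow> (\<forall>i\<in>{1..n}. A i \<subseteq> C)"

definition committees :: "'c set \<Rightarrow> nat \<Rightarrow> 'c set set" where
  "committees C k = {W. W \<subseteq> C \<and> card W = k}"

(* For an empty group the intersection would be UNIV; for n, k > 0 the size condition
   excludes that case. *)
definition justified_representation ::
    "nat \<Rightarrow> (nat \<Rightarrow> 'c set) \<Rightarrow> nat \<Rightarrow> 'c set \<Rightarrow> bool" where
  "justified_representation n A k W \<longleftrightarrow>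
     \<not> (\<exists>M \<subseteq> {1..n}. real (card M) \<ge> real n / real k \<and>
            (\<Inter>i\<in>M. A i) \<noteq> {} \<and> (\<forall>i\<in>M. A i \<inter> W = {}))"

definition pav_score :: "nat \<Rightarrow> (nat \<Rightarrow> 'c set) \<Rightarrow> 'c set \<Rightarrow> real" where
  "pav_score n A W = (\<Sum>i\<in>{1..n}. harm (card (W \<inter> A i)))"

(* All committees that some tie-breaking can select. *)
definition pav_winners :: "nat \<Rightarrow> 'c set \<Rightarrow> (nat \<Rightarrow> 'c set) \<Rightarrow> nat \<Rightarrow> 'c set set" where
  "pav_winners n C A k = {W. is_arg_max (pav_score n A) (\<lambda>W. W \<in> committees C k) W}"

end

theory Submission
  imports Defs
begin

text \<open>
  Suppose that a group \<open>M\<close> of at least \<open>n/k\<close> voters, all approving a candidate \<open>c\<close>, is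
  unrepresented by a PAV winner \<open>W\<close>. Removing \<open>w \<in> W\<close> costs each supporter \<open>i\<close> of \<open>w\<close> exactly
  \<open>1 / |W \<inter> A\<^sub>i|\<close>; over all \<open>w \<in> W\<close> these costs add up to the number of represented voters,
  which is at most \<open>n - |M|\<close> and so less than \<open>k |M|\<close>. Hence some \<open>w\<close> costs less than \<open>|M|\<close>,
  while adding \<open>c\<close> gains at least \<open>|M|\<close>, so exchanging \<open>w\<close> for \<open>c\<close> increases the score.
\<close>

lemma harm_le_harm: "m \<le> n \<Longrightarrow> (harm m :: real) \<le> harm n"
  unfolding harm_def by (intro sum_mono2) auto

lemma harm_diff_one: "0 < n \<Longrightarrow> (harm (n - 1) :: real) = harm n - 1 / real n"
  using harm_Suc[of "n - 1", where ?'a = real] by (simp add: inverse_eq_divide)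

text \<open>For finite \<open>W\<close> and \<open>w \<in> W\<close> this is the exact drop in score
  from \<open>W\<close> to \<open>W - {w}\<close>; no term that counts then divides by zero.\<close>

definition removal_cost :: "nat \<Rightarrow> (nat \<Rightarrow> 'c set) \<Rightarrow> 'c set \<Rightarrow> 'c \<Rightarrow> real" where
  "removal_cost n A W w = (\<Sum>i\<in>{1..n}. if w \<in> A i then 1 / real (card (W \<inter> A i)) else 0)"

text \<open>Double counting: a represented voter is charged \<open>1 / card (W \<inter> A i)\<close>
  once for each member of \<open>W \<inter> A i\<close>, hence 1 in total; any other voter is
  charged nothing.\<close>

lemma sum_removal_cost:
  assumes "finite W"
  shows "(\<Sum>w\<in>W. removal_cost n A W w) = real (card {i\<in>{1..n}. W \<inter> A i \<noteq> {}})"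
proof -
  have "(\<Sum>w\<in>W. removal_cost n A W w) =
      (\<Sum>i\<in>{1..n}. \<Sum>w\<in>W. if w \<in> A i then 1 / real (card (W \<inter> A i)) else 0)"
    unfolding removal_cost_def by (rule sum.swap)
  also have "\<dots> = (\<Sum>i\<in>{1..n}. if W \<inter> A i \<noteq> {} then 1 else 0)"
    using assms by (intro sum.cong) (auto simp flip: sum.inter_restrict)
  also have "\<dots> = real (card {i\<in>{1..n}. W \<inter> A i \<noteq> {}})"
    by (simp flip: sum.inter_filter)
  finally show ?thesis .
qed

text \<open>The bound holds voter by voter. It need not be an equality, since voters outside
  \<open>M\<close> may approve \<open>c\<close> too.\<close>

lemma pav_score_exchange:
  assumes W: "finite W" "w \<in> W" "c \<notin> W"
    and M: "M \<subseteq> {1..n}" "\<And>i. i \<in> M \<Longrightarrow> c \<in> A i" "\<And>i. i \<in> M \<Longrightarrow> A i \<inter> W = {}"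
  shows "pav_score n A (insert c (W - {w})) \<ge> pav_score n A W + real (card M) - removal_cost n A W w"
proof -
  let ?W = "insert c (W - {w})"
  have voter: "harm (card (?W \<inter> A i)) \<ge> harm (card (W \<inter> A i)) + (if i \<in> M then 1 else 0)
      - (if w \<in> A i then 1 / real (card (W \<inter> A i)) else 0)" (is "?R \<ge> _") for i
  proof (cases "i \<in> M")
    case True
    \<comment> \<open>Such a voter rises from \<open>harm 0 = 0\<close> to \<open>harm 1 = 1\<close>
      and loses nothing with \<open>w\<close>.\<close>
    with M(2,3)[of i] W have "?W \<inter> A i = {c}" "W \<inter> A i = {}" "w \<notin> A i"
      by auto
    with True show ?thesis
      by (simp add: harm_def)
  next
    case False
    \<comment> \<open>Outside \<open>M\<close>, \<open>c\<close> can only help, so it suffices to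
      bound the loss from deleting \<open>w\<close>.\<close>
    have "card ((W - {w}) \<inter> A i) \<le> card (?W \<inter> A i)"
      using W by (intro card_mono) auto
    then have ge: "harm (card ((W - {w}) \<inter> A i)) \<le> ?R"
      by (rule harm_le_harm)
    show ?thesis
    proof (cases "w \<in> A i")
      case True
      have "(W - {w}) \<inter> A i = (W \<inter> A i) - {w}"
        by auto
      with True W have "card ((W - {w}) \<inter> A i) = card (W \<inter> A i) - 1"
        by simp
      moreover have "0 < card (W \<inter> A i)"
        using True W by (auto simp: card_gt_0_iff)
      ultimately have "harm (card ((W - {w}) \<inter> A i)) =
          harm (card (W \<inter> A i)) - 1 / real (card (W \<inter> A i))"
        by (metis harm_diff_one)
      with ge True False show ?thesis
        by simp
    next
      case w: False
      then have "(W - {w}) \<inter> A i = W \<inter> A i"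
        by auto
      with ge w False show ?thesis
        by simp
    qed
  qed
  have "(\<Sum>i\<in>{1..n}. if i \<in> M then 1 else 0 :: real) = real (card M)"
    using M(1) by (simp add: Int_absorb1 flip: sum.inter_restrict)
  then have "pav_score n A W + real (card M) - removal_cost n A W w =
      (\<Sum>i\<in>{1..n}. harm (card (W \<inter> A i)) + (if i \<in> M then 1 else 0)
        - (if w \<in> A i then 1 / real (card (W \<inter> A i)) else 0))"
    unfolding pav_score_def removal_cost_def by (simp add: sum.distrib sum_subtractf)
  also have "\<dots> \<le> pav_score n A ?W"
    unfolding pav_score_def by (intro sum_mono voter)
  finally show ?thesis .
qed

theorem theorem6:
  fixes n k :: nat and C :: "'c set" and A :: "nat \<Rightarrow> 'c set"
  assumes "n \<ge> 1"
    and "finite C"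
    and "ballot_profile n C A"
    and "1 \<le> k" and "k \<le> card C"
  shows "\<forall>W \<in> pav_winners n C A k. justified_representation n A k W"
proof (rule ballI, unfold justified_representation_def, rule notI, elim exE conjE)
  fix W M
  assume "W \<in> pav_winners n C A k" and M: "M \<subseteq> {1..n}"
    and large: "real n / real k \<le> real (card M)"
    and common: "(\<Inter>i\<in>M. A i) \<noteq> {}" and unrep: "\<forall>i\<in>M. A i \<inter> W = {}"
  then have W: "W \<subseteq> C" "card W = k"
    and max: "\<And>V. V \<subseteq> C \<Longrightarrow> card V = k \<Longrightarrow> pav_score n A V \<le> pav_score n A W"
    by (auto simp: pav_winners_def is_arg_max_def committees_def not_less)
  have finW: "finite W" and finM: "finite M"
    using W(1) \<open>finite C\<close> M by (auto intro: finite_subset)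
  \<comment> \<open>\<open>M\<close> must be nonempty: a ballot of one of its members places
    \<open>c\<close> in \<open>C\<close>, whereas an empty intersection would be
    \<open>UNIV\<close>.\<close>
  have "0 < real n / real k"
    using \<open>n \<ge> 1\<close> \<open>1 \<le> k\<close> by simp
  with large have cardM: "0 < card M"
    by linarith
  then obtain i where i: "i \<in> M"
    by fastforce
  obtain c where c: "\<And>i. i \<in> M \<Longrightarrow> c \<in> A i"
    using common by auto
  have "A i \<subseteq> C"
    using i M \<open>ballot_profile n C A\<close> by (auto simp: ballot_profile_def)
  then have "c \<in> C" "c \<notin> W"
    using i c[OF i] unrep by auto
  have "\<exists>w\<in>W. removal_cost n A W w < real (card M)"
  proof (rule ccontr)
    assume "\<not> ?thesis"
    then have "(\<Sum>w\<in>W. real (card M)) \<le> (\<Sum>w\<in>W. removal_cost n A W w)"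
      by (intro sum_mono) (simp add: not_less)
    then have "real k * real (card M) \<le> real (card {i\<in>{1..n}. W \<inter> A i \<noteq> {}})"
      using W by (simp add: sum_removal_cost[OF finW])
    also have "card {i\<in>{1..n}. W \<inter> A i \<noteq> {}} \<le> card ({1..n} - M)"
      using unrep by (intro card_mono) auto
    \<comment> \<open>Strict because \<open>M\<close> is nonempty; this contradicts
      \<open>n \<le> k * card M\<close>, which is \<open>large\<close> with denominators
      cleared.\<close>
    also have "\<dots> < n"
      using M cardM finM card_mono[OF _ M] by (simp add: card_Diff_subset)
    finally show False
      using large \<open>1 \<le> k\<close> by (simp add: field_simps)
  qed
  then obtain w where w: "w \<in> W" "removal_cost n A W w < real (card M)"
    by blast
  have "pav_score n A W < pav_score n A (insert c (W - {w}))"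
    using pav_score_exchange[OF finW w(1) \<open>c \<notin> W\<close> M, of A] c unrep w(2) by fastforce
  moreover have "card (insert c (W - {w})) = k"
    using W(2) finW w(1) \<open>c \<notin> W\<close> \<open>1 \<le> k\<close> by (simp add: card_Diff_singleton)
  moreover have "insert c (W - {w}) \<subseteq> C"
    using W(1) \<open>c \<in> C\<close> by auto
  ultimately show False
    using max[of "insert c (W - {w})"] by linarith
qed

end
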